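(* Let $\mathbb{F}$ be an algebraically closed field with $\mathrm{Char}(\mathbb{F})\neq 2$, let $p\in\mathbb{F}$ with $p\ne 0$, $p\neq 1$, let $N$ be a feasible integer, and let $V=\mathrm{Span}\{y^{N-i}z^i\}_{i=0}^N\subset\mathbb{F}[y,z]$ be the space of homogeneous polynomials of total degree $N$ in commuting indeterminates $y,z$. For $i=0,\ldots,N$ put $k_i=\binom{N}{i}\left(\frac{p}{1-p}\right)^i$, and let $\langle\,,\,\rangle:V\times V\to\mathbb{F}$ be the bilinear form with $$\langle y^{N-i}z^i,y^{N-j}z^j\rangle=\delta_{i,j}\frac{1}{k_i(1-p)^N},\qquad i,j=0,1,\ldots,N.$$ Let $y^*=(1-p)y+pz$ and $z^*=(1-p)y+(p-1)z$. Then for $i,j=0,1,\ldots,N$, $$\langle y^{N-i}z^{i},{y^*}^{N-j}{z^*}^{j}\rangle=K_i(j),$$ where $K_i=K_i(x;p,N)$ is the $i$th Krawtchouk polynomial.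
   Context: An integer $N$ is feasible if $N\ge 0$ when $\mathrm{Char}(\mathbb{F})=0$, and $0\le N<\mathrm{Char}(\mathbb{F})$ when $\mathrm{Char}(\mathbb{F})>0$. With $(\alpha)_n=\alpha(\alpha+1)\cdots(\alpha+n-1)$, $(\alpha)_0=1$, the Krawtchouk polynomials with parameters $p$ and $N$ are the polynomials in $\mathbb{F}[x]$ $$K_i(x)=K_i(x;p,N)={}_2F_1\left(-i,-x;-N;\tfrac1p\right)=\sum_{n=0}^{i}\frac{(-i)_n(-x)_n}{(-N)_n\,n!}\,p^{-n},\qquad i=0,1,\ldots,N.$$ *)

theory Defs
  imports "HOL-Computational_Algebra.Computational_Algebra"
begin

text \<open>The hypothesis \<open>N \<ge> 0\<close> of feasibility is carried by the type \<^typ>\<open>nat\<close>.\<close>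

definition feasible :: "'a::field itself \<Rightarrow> nat \<Rightarrow> bool" where
  "feasible _ N \<longleftrightarrow> CHAR('a) = 0 \<or> N < CHAR('a)"

text \<open>
  The polynomial variable \<open>x\<close> is \<^term>\<open>[:0, 1:]\<close>, and \<^const>\<open>pochhammer\<close> is the shifted
  factorial \<open>(\<alpha>)\<^sub>n\<close>, used both in the field and in the polynomial ring. The factorial
  is taken in \<^typ>\<open>nat\<close> and then embedded, since \<^const>\<open>fact\<close> itself requires characteristic zero.
\<close>

definition krawtchouk :: "'a::field \<Rightarrow> nat \<Rightarrow> nat \<Rightarrow> 'a poly" where
  "krawtchouk p N i =
     (\<Sum>n = 0..i.
        smult (pochhammer (- of_nat i) n / (pochhammer (- of_nat N) n * of_nat (fact n)) * (1 / p) ^ n)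
          (pochhammer (- [:0, 1:]) n))"

text \<open>
  The ring of polynomials in \<open>y\<close> and \<open>z\<close> is represented as polynomials in \<open>z\<close> whose
  coefficients are polynomials in \<open>y\<close>; thus the coefficient of \<open>y\<^sup>a z\<^sup>b\<close> in \<open>f\<close> is
  \<^term>\<open>coeff (coeff f b) a\<close>.
\<close>

definition Yvar :: "'a::field poly poly" where
  "Yvar = [:[:0, 1:]:]"

definition Zvar :: "'a::field poly poly" where
  "Zvar = [:0, 1:]"

definition scale2 :: "'a::field \<Rightarrow> 'a poly poly \<Rightarrow> 'a poly poly" where
  "scale2 c f = smult [:c:] f"

global_interpretation poly2: vector_space "scale2 :: 'a::field \<Rightarrow> _"
  by standard (simp_all add: scale2_def smult_add_right mult.commute
      flip: smult_add_left one_pCons)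

definition homog_space :: "nat \<Rightarrow> 'a::field poly poly set" where
  "homog_space N = module.span scale2 ((\<lambda>i. Yvar ^ (N - i) * Zvar ^ i) ` {0..N})"

text \<open>
  Bilinearity over the field on the subspace \<open>V\<close>; values outside \<open>V\<close> are irrelevant.
\<close>

definition bilinear_form_on ::
  "'a::field poly poly set \<Rightarrow> ('a poly poly \<Rightarrow> 'a poly poly \<Rightarrow> 'a) \<Rightarrow> bool" where
  "bilinear_form_on V B \<longleftrightarrow>
     (\<forall>u\<in>V. \<forall>v\<in>V. \<forall>w\<in>V. B (u + v) w = B u w + B v w) \<and>
     (\<forall>u\<in>V. \<forall>v\<in>V. \<forall>w\<in>V. B u (v + w) = B u v + B u w) \<and>
     (\<forall>c. \<forall>u\<in>V. \<forall>v\<in>V. B (scale2 c u) v = c * B u v) \<and>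
     (\<forall>c. \<forall>u\<in>V. \<forall>v\<in>V. B u (scale2 c v) = c * B u v)"

definition kcoef :: "'a::field \<Rightarrow> nat \<Rightarrow> nat \<Rightarrow> 'a" where
  "kcoef p N i = of_nat (N choose i) * (p / (1 - p)) ^ i"

definition is_krawtchouk_form ::
  "'a::field \<Rightarrow> nat \<Rightarrow> ('a poly poly \<Rightarrow> 'a poly poly \<Rightarrow> 'a) \<Rightarrow> bool" where
  "is_krawtchouk_form p N B \<longleftrightarrow>
     bilinear_form_on (homog_space N) B \<and>
     (\<forall>i\<in>{0..N}. \<forall>j\<in>{0..N}.
        B (Yvar ^ (N - i) * Zvar ^ i) (Yvar ^ (N - j) * Zvar ^ j) =
        (if i = j then 1 / (kcoef p N i * (1 - p) ^ N) else 0))"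

lemma coeff_monomial2:
  "coeff (coeff (Yvar ^ a * Zvar ^ b :: 'a::field poly poly) n) m = (if n = b \<and> m = a then 1 else 0)"
proof -
  have "(Yvar ^ a :: 'a poly poly) = [:monom 1 a:]"
    by (simp add: Yvar_def poly_const_pow monom_altdef)
  moreover have "(Zvar ^ b :: 'a poly poly) = monom 1 b"
    by (simp add: Zvar_def monom_altdef)
  ultimately show ?thesis
    by simp
qed

text \<open>Such a form exists, and it is unique on the homogeneous space, so a statement
  about all forms with this property is a statement about the form.\<close>

lemma krawtchouk_form_exists: "\<exists>B. is_krawtchouk_form (p :: 'a::field) N B"
proof -
  define c where "c m f = coeff (coeff f m) (N - m)" for m and f :: "'a poly poly"
  define d where "d m = 1 / (kcoef p N m * (1 - p) ^ N)" for m
  define B where "B u v = (\<Sum>m\<le>N. d m * c m u * c m v)" for u v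
  have add: "c m (u + v) = c m u + c m v" for m u v
    by (simp add: c_def)
  have scale: "c m (scale2 x u) = x * c m u" for m x u
    by (simp add: c_def scale2_def)
  have "bilinear_form_on (homog_space N) B"
    by (simp add: bilinear_form_on_def B_def add scale ring_distribs sum.distrib
        sum_distrib_left mult_ac)
  moreover have "B (Yvar ^ (N - i) * Zvar ^ i) (Yvar ^ (N - j) * Zvar ^ j) = (if i = j then d i else 0)"
    if "i \<le> N" "j \<le> N" for i j
  proof -
    have "B (Yvar ^ (N - i) * Zvar ^ i) (Yvar ^ (N - j) * Zvar ^ j) =
        (\<Sum>m\<le>N. if m = i then (if i = j then d i else 0) else 0)"
      unfolding B_def by (intro sum.cong) (auto simp: c_def coeff_monomial2)
    then show ?thesis using that by simp
  qed
  ultimately show ?thesis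
    by (intro exI[of _ B]) (auto simp: is_krawtchouk_form_def d_def)
qed

lemma krawtchouk_form_unique:
  assumes "is_krawtchouk_form p N B" "is_krawtchouk_form p N B'"
    and u: "u \<in> homog_space N" and v: "v \<in> homog_space N"
  shows "B u v = B' u v"
proof -
  define S :: "'a poly poly set" where "S = (\<lambda>i. Yvar ^ (N - i) * Zvar ^ i) ` {0..N}"
  define V where "V = poly2.span S"
  have V: "homog_space N = V"
    by (simp add: homog_space_def V_def S_def)
  have bil: "bilinear_form_on V B" "bilinear_form_on V B'"
    using assms(1,2) by (simp_all add: is_krawtchouk_form_def V)
  have eq: "B x y = B' x y" if "x \<in> S" "y \<in> S" for x y
    using that assms(1,2) by (auto simp: is_krawtchouk_form_def S_def)
  have SV: "x \<in> V" if "x \<in> S" for x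
    using that by (simp add: V_def poly2.span_base)
  have sV: "scale2 c x \<in> V" if "x \<in> V" for c x
    using that by (simp add: V_def poly2.span_scale)
  have right: "F x (scale2 c y + w) = c * F x y + F x w"
    and left: "F (scale2 c y + w) x = c * F y x + F w x"
    if "bilinear_form_on V F" "x \<in> V" "y \<in> V" "w \<in> V" for F c x y w
    using that sV[of y c] by (simp_all add: bilinear_form_on_def)
  have zero: "F 0 w = 0" "F w 0 = 0" if "bilinear_form_on V F" "w \<in> V" for F w
  proof -
    have "F (scale2 0 w) w = 0 * F w w" "F w (scale2 0 w) = 0 * F w w"
      using that unfolding bilinear_form_on_def by blast+
    then show "F 0 w = 0" "F w 0 = 0"
      by simp_all
  qed
  have comb: "scale2 c y + w \<in> V" if "y \<in> S" "w \<in> V" for c y w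
    using that sV[OF SV] by (auto simp: V_def intro: poly2.span_add)
  have 0: "0 \<in> V"
    by (simp add: V_def poly2.span_zero)
  have *: "w \<in> V \<and> B x w = B' x w" if x: "x \<in> S" and w: "w \<in> poly2.span S" for x w
    using w
  proof (induction rule: poly2.span_induct_alt)
    case base
    then show ?case by (simp add: zero bil SV x 0)
  next
    case (step c y w)
    then show ?case by (simp add: right bil SV x eq comb)
  qed
  have "u \<in> V \<and> B u v = B' u v"
    using u unfolding V V_def
  proof (induction rule: poly2.span_induct_alt)
    case base
    then show ?case using v V by (simp add: zero bil poly2.span_zero)
  next
    case (step c y u)
    then show ?case
      using v V * comb by (simp add: left bil SV flip: V_def)
  qed
  then show ?thesis ..
qed

end

theory Submission
  imports Defs
begin

text \<open>
  Since \<open>z\<^sup>* = y\<^sup>* - z\<close>, two binomial expansions give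
  \<open>(y\<^sup>*)\<^bsup>N-j\<^esup> (z\<^sup>*)\<^bsup>j\<^esup> = (\<Sum>n. (-1)\<^bsup>n\<^esup> (j choose n) z\<^bsup>n\<^esup> ((1 - p) y + p z)\<^bsup>N-n\<^esup>)\<close>,
  and pairing with \<open>y\<^bsup>N-i\<^esup> z\<^bsup>i\<^esup>\<close> extracts a coefficient:
  \<open>(\<Sum>n. (-1)\<^bsup>n\<^esup> (j choose n) (N - n choose i - n) p\<^bsup>i-n\<^esup> (1 - p)\<^bsup>N-i\<^esup>)\<close>, divided by
  \<open>(N choose i) p\<^bsup>i\<^esup> (1 - p)\<^bsup>N-i\<^esup>\<close>. As \<open>(-a)\<^sub>n = (-1)\<^bsup>n\<^esup> n! (a choose n)\<close>, this is the
  hypergeometric sum term by term; feasibility makes \<open>N!\<close> invertible.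
\<close>

text \<open>Both sides are images of integers, so the identity is verified in the reals, through
  generalized binomials, and transported to the ring along \<open>of_int\<close>.\<close>

lemma pochhammer_minus_of_nat:
  "pochhammer (- of_nat a :: 'a::comm_ring_1) n = (-1) ^ n * of_nat (fact n * (a choose n))"
proof -
  have "pochhammer (- int a) n = (-1) ^ n * int (fact n * (a choose n))"
  proof -
    have "real_of_int (pochhammer (- int a) n) = pochhammer (- of_nat a) n"
      by (simp add: pochhammer_of_int[symmetric])
    also have "\<dots> = (-1) ^ n * (fact n * (of_nat a gchoose n))"
      by (simp add: gbinomial_pochhammer mult.assoc[symmetric] power_mult_distrib[symmetric])
    also have "\<dots> = real_of_int ((-1) ^ n * int (fact n * (a choose n)))"
      by (simp add: binomial_gbinomial)
    finally show ?thesis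
      by linarith
  qed
  then have "of_int (pochhammer (- int a) n) = (of_int ((-1) ^ n * int (fact n * (a choose n))) :: 'a)"
    by (rule arg_cong)
  then show ?thesis
    by (simp add: pochhammer_of_int[symmetric] del: of_nat_fact)
qed

lemma poly_pochhammer: "poly (pochhammer q n) x = pochhammer (poly q x) n"
  for x :: "'a::comm_semiring_1"
  by (induction n) (simp_all add: pochhammer_Suc)

text \<open>The factors \<open>1, ..., n\<close> all lie below a positive characteristic, so none of
  them vanishes in the field.\<close>

lemma feasible_of_nat_fact_neq_0:
  assumes "feasible TYPE('a::field) N" "n \<le> N"
  shows "(of_nat (fact n) :: 'a) \<noteq> 0"
  using assms(2)
proof (induction n)
  case (Suc n)
  have "\<not> CHAR('a) dvd Suc n"
    using Suc.prems assms(1) by (auto simp: feasible_def dest: dvd_imp_le)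
  then have "(of_nat (Suc n) :: 'a) \<noteq> 0"
    by (simp only: of_nat_eq_0_iff_char_dvd not_False_eq_True)
  then show ?case
    using Suc by (simp only: fact_Suc of_nat_mult of_nat_id) simp
qed simp

lemma feasible_of_nat_binomial_neq_0:
  assumes "feasible TYPE('a::field) N" "n \<le> N"
  shows "(of_nat (N choose n) :: 'a) \<noteq> 0"
proof
  assume "(of_nat (N choose n) :: 'a) = 0"
  then have "(of_nat (fact n * fact (N - n) * (N choose n)) :: 'a) = 0"
    by simp
  then have "(of_nat (fact N) :: 'a) = 0"
    using assms(2) by (simp only: binomial_fact_lemma)
  then show False
    using feasible_of_nat_fact_neq_0[OF assms(1) order_refl] by contradiction
qed

lemma krawtchouk_eval:
  fixes p :: "'a::field"
  assumes "feasible TYPE('a) N" "p \<noteq> 0" "i \<le> N"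
  shows "poly (krawtchouk p N i) (of_nat j) =
    (\<Sum>n\<le>i. (-1) ^ n * of_nat (j choose n) * of_nat (N - n choose (i - n)) / (of_nat (N choose i) * p ^ n))"
proof -
  have "pochhammer (- of_nat i) n / (pochhammer (- of_nat N) n * of_nat (fact n)) * (1 / p) ^ n
        * pochhammer (- of_nat j) n
      = (-1) ^ n * of_nat (j choose n) * of_nat (N - n choose (i - n)) / (of_nat (N choose i) * p ^ n)"
    if "n \<le> i" for n
  proof -
    have "n \<le> N"
      using that assms(3) by simp
    have nz: "(of_nat (fact n) :: 'a) \<noteq> 0" "(of_nat (N choose n) :: 'a) \<noteq> 0"
      "(of_nat (N choose i) :: 'a) \<noteq> 0"
      by (intro feasible_of_nat_fact_neq_0[OF assms(1)]
          feasible_of_nat_binomial_neq_0[OF assms(1)] \<open>n \<le> N\<close> assms(3))+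
    \<comment> \<open>This trades the denominator \<open>N choose n\<close> for
      \<open>N choose i\<close>, which does not depend on \<open>n\<close> and is the one occurring
      in \<open>kcoef\<close>.\<close>
    have "(of_nat (N choose i) * of_nat (i choose n) :: 'a)
        = of_nat (N choose n) * of_nat (N - n choose (i - n))"
      using choose_mult[OF that assms(3)] by (metis of_nat_mult)
    then show ?thesis
      using nz assms(2)
      by (simp add: pochhammer_minus_of_nat power_one_over field_simps del: of_nat_fact)
  qed
  then show ?thesis
    by (auto simp: krawtchouk_def poly_sum poly_pochhammer atLeast0AtMost intro!: sum.cong)
qed

lemma scale2_eq_mult: "scale2 c f = [:[:c:]:] * f"
  by (simp add: scale2_def)

lemma coeff_scale2: "coeff (coeff (scale2 c f) n) m = c * coeff (coeff f n) m"
  by (simp add: scale2_def)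

text \<open>The monomials are orthogonal, so linearity in \<open>v\<close> leaves only its
  coefficient at the \<open>i\<close>th monomial.\<close>

lemma krawtchouk_form_monomial_left:
  assumes B: "is_krawtchouk_form p N B" and i: "i \<le> N" and v: "v \<in> homog_space N"
  shows "B (Yvar ^ (N - i) * Zvar ^ i) v
    = coeff (coeff v i) (N - i) / (kcoef p N i * (1 - p) ^ N)"
proof -
  let ?u = "\<lambda>i. Yvar ^ (N - i) * Zvar ^ i :: 'a poly poly"
  have u: "?u m \<in> homog_space N" if "m \<le> N" for m
    using that unfolding homog_space_def by (intro poly2.span_base) auto
  have bil: "bilinear_form_on (homog_space N) B"
    using B by (simp add: is_krawtchouk_form_def)
  from v have "v \<in> poly2.span (?u ` {0..N})"
    by (simp only: homog_space_def)
  \<comment> \<open>Membership is carried through the induction because \<open>B\<close> is known to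
    be bilinear only on \<open>homog_space N\<close>.\<close>
  then have "v \<in> homog_space N \<and>
      B (?u i) v = coeff (coeff v i) (N - i) / (kcoef p N i * (1 - p) ^ N)"
  proof (induction rule: poly2.span_induct_alt)
    case base
    have "0 \<in> homog_space N"
      unfolding homog_space_def by (rule poly2.span_zero)
    moreover have "B (?u i) (scale2 0 (?u i)) = 0 * B (?u i) (?u i)"
      using bil u[OF i] unfolding bilinear_form_on_def by blast
    ultimately show ?case
      by simp
  next
    case (step c x w)
    then obtain m where m: "m \<le> N" "x = ?u m"
      by auto
    have cx: "scale2 c x \<in> homog_space N"
      using u[OF m(1)] unfolding m(2) homog_space_def by (rule poly2.span_scale)
    then have "scale2 c x + w \<in> homog_space N"
      using step unfolding homog_space_def by (blast intro: poly2.span_add)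
    moreover have "B (?u i) (scale2 c x + w) = c * B (?u i) x + B (?u i) w"
      using bil u[OF i] u[OF m(1)] cx step unfolding bilinear_form_on_def m(2) by simp
    moreover have "B (?u i) x = (if i = m then 1 / (kcoef p N i * (1 - p) ^ N) else 0)"
      using B i m by (simp add: is_krawtchouk_form_def)
    ultimately show ?case
      using step by (auto simp: m(2) coeff_scale2 coeff_monomial2 add_divide_distrib)
  qed
  then show ?thesis
    by blast
qed

text \<open>Here \<open>n\<close> counts the factors \<open>- Zvar\<close> chosen from
  \<open>zstar = ystar - Zvar\<close>, and \<open>k\<close> the factors \<open>Zvar\<close> chosen
  from the remaining \<open>N - n\<close> copies of \<open>ystar\<close>. Written as a combination
  of monomials, the result yields both coefficients and membership in the span.\<close>

lemma dual_monomial_expansion: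
  fixes p :: "'a::field"
  assumes "j \<le> N"
  defines "ystar \<equiv> scale2 (1 - p) Yvar + scale2 p Zvar"
    and "zstar \<equiv> scale2 (1 - p) Yvar + scale2 (p - 1) Zvar"
  shows "ystar ^ (N - j) * zstar ^ j = (\<Sum>n\<le>j. \<Sum>k\<le>N - n.
    scale2 ((-1) ^ n * of_nat (j choose n) * of_nat (N - n choose k) * p ^ k * (1 - p) ^ (N - n - k))
      (Yvar ^ (N - (n + k)) * Zvar ^ (n + k)))"
proof -
  have "scale2 (p - 1) Zvar = scale2 p Zvar - Zvar"
    by (simp add: poly2.scale_left_diff_distrib)
  then have zstar: "zstar = - Zvar + ystar"
    by (simp add: ystar_def zstar_def)
  \<comment> \<open>Scalars become constant polynomials, so that \<open>binomial_ring\<close>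
    applies and the coefficients can be merged afterwards.\<close>
  have const: "[:[:c:]:] ^ n = [:[:c ^ n:]:]" "of_nat n = [:[:of_nat n:]:]"
    "[:[:c:]:] * [:[:d:]:] = [:[:c * d:]:]" "(-1) = [:[:-1:]:]" for n and c d :: 'a
    by (simp_all add: poly_const_pow of_nat_poly one_pCons)
  have pow: "ystar ^ (N - n) = (\<Sum>k\<le>N - n. scale2 (of_nat (N - n choose k) * p ^ k * (1 - p) ^ (N - n - k))
      (Yvar ^ (N - (n + k)) * Zvar ^ k))" for n
  proof -
    have "ystar = [:[:p:]:] * Zvar + [:[:1 - p:]:] * Yvar"
      by (simp only: ystar_def scale2_eq_mult add.commute)
    then have "ystar ^ (N - n) = (\<Sum>k\<le>N - n. of_nat (N - n choose k) * ([:[:p:]:] ^ k * Zvar ^ k) *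
        ([:[:1 - p:]:] ^ (N - n - k) * Yvar ^ (N - n - k)))"
      by (simp only: binomial_ring power_mult_distrib)
    also have "\<dots> = (\<Sum>k\<le>N - n. (of_nat (N - n choose k) * [:[:p:]:] ^ k * [:[:1 - p:]:] ^ (N - n - k)) *
        (Yvar ^ (N - (n + k)) * Zvar ^ k))"
      by (intro sum.cong) (simp_all only: mult_ac diff_diff_left)
    finally show ?thesis
      by (simp only: const scale2_eq_mult)
  qed
  have "ystar ^ (N - j) * zstar ^ j
      = (\<Sum>n\<le>j. of_nat (j choose n) * (- Zvar) ^ n * (ystar ^ (j - n) * ystar ^ (N - j)))"
    unfolding zstar binomial_ring sum_distrib_left by (intro sum.cong) (simp_all only: mult_ac)
  also have "\<dots> = (\<Sum>n\<le>j. ((-1) ^ n * of_nat (j choose n)) * Zvar ^ n * ystar ^ (N - n))"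
    using assms(1)
    by (intro sum.cong) (simp_all flip: power_add add: power_minus[of Zvar] mult_ac)
  also have "\<dots> = (\<Sum>n\<le>j. \<Sum>k\<le>N - n. ([:[:(-1) ^ n * of_nat (j choose n):]:] *
      [:[:of_nat (N - n choose k) * p ^ k * (1 - p) ^ (N - n - k):]:]) *
      (Yvar ^ (N - (n + k)) * Zvar ^ (n + k)))"
    unfolding pow sum_distrib_left
    by (intro sum.cong) (simp_all only: const scale2_eq_mult mult_ac power_add)
  finally show ?thesis
    by (simp only: const scale2_eq_mult mult.assoc)
qed

lemma coeff_dual_monomial:
  fixes p :: "'a::field"
  assumes "j \<le> N" "i \<le> N"
  defines "ystar \<equiv> scale2 (1 - p) Yvar + scale2 p Zvar"
    and "zstar \<equiv> scale2 (1 - p) Yvar + scale2 (p - 1) Zvar"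
  shows "coeff (coeff (ystar ^ (N - j) * zstar ^ j) i) (N - i) =
    (\<Sum>n\<le>i. (-1) ^ n * of_nat (j choose n) * of_nat (N - n choose (i - n)) * p ^ (i - n) * (1 - p) ^ (N - i))"
    (is "?L = (\<Sum>n\<le>i. ?f n)")
proof -
  \<comment> \<open>Only \<open>k = i - n\<close> contributes. The test \<open>n \<le> i\<close>
    guards against truncated subtraction, which would otherwise select \<open>k = 0\<close>.\<close>
  have inner: "(\<Sum>k\<le>N - n. (-1) ^ n * of_nat (j choose n) * of_nat (N - n choose k) * p ^ k
        * (1 - p) ^ (N - n - k) * (if i = n + k \<and> N - i = N - (n + k) then 1 else 0))
      = (if n \<le> i then ?f n else 0)" (is "?S = _") for n
  proof -
    have "?S = (\<Sum>k\<le>N - n. if k = i - n then (if n \<le> i then ?f n else 0) else 0)"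
      using assms(2) by (intro sum.cong) auto
    then show ?thesis
      using assms(2) by auto
  qed
  have "?L = (\<Sum>n\<le>j. if n \<le> i then ?f n else 0)"
    unfolding ystar_def zstar_def dual_monomial_expansion[OF assms(1)] coeff_sum coeff_scale2
      coeff_monomial2 inner ..
  \<comment> \<open>The ranges differ harmlessly: for \<open>i < n\<close> the summand is 0 by the
    test, and for \<open>j < n\<close> the factor \<open>j choose n\<close> vanishes.\<close>
  also have "\<dots> = (\<Sum>n\<le>i. ?f n)"
    by (rule sum.mono_neutral_cong) (auto simp: binomial_eq_0)
  finally show ?thesis .
qed

text \<open>Each monomial in the expansion has \<open>z\<close>-exponent
  \<open>n + k \<le> N\<close>, hence is one of the generators.\<close>

lemma dual_monomial_in_homog_space:
  assumes "j \<le> N"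
  shows "(scale2 (1 - p) Yvar + scale2 p Zvar) ^ (N - j) *
      (scale2 (1 - p) Yvar + scale2 (p - 1) Zvar) ^ j \<in> homog_space N"
  unfolding dual_monomial_expansion[OF assms] homog_space_def
  using assms
  by (intro poly2.span_sum poly2.span_scale poly2.span_base) auto

theorem lemma3p20:
  fixes p :: "'a::alg_closed_field" and N :: nat
    and B :: "'a poly poly \<Rightarrow> 'a poly poly \<Rightarrow> 'a"
    and ystar zstar :: "'a poly poly"
  assumes "CHAR('a) \<noteq> 2"
    and "p \<noteq> 0" and "p \<noteq> 1"
    and "feasible TYPE('a) N"
    and "is_krawtchouk_form p N B"
    and "ystar = scale2 (1 - p) Yvar + scale2 p Zvar"
    and "zstar = scale2 (1 - p) Yvar + scale2 (p - 1) Zvar"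
  shows "\<forall>i\<in>{0..N}. \<forall>j\<in>{0..N}.
    B (Yvar ^ (N - i) * Zvar ^ i) (ystar ^ (N - j) * zstar ^ j)
      = poly (krawtchouk p N i) (of_nat j)"
proof (intro ballI)
  fix i j
  assume "i \<in> {0..N}" "j \<in> {0..N}"
  then have ij: "i \<le> N" "j \<le> N"
    by simp_all
  have q: "1 - p \<noteq> 0"
    using assms(3) by simp
  \<comment> \<open>The denominator of \<open>kcoef\<close> cancels \<open>i\<close> of the factors
    \<open>1 - p\<close>; the remaining \<open>N - i\<close> cancel later against the extracted
    coefficient, and \<open>p ^ (i - n) / p ^ i\<close> leaves \<open>1 / p ^ n\<close>.\<close>
  have "kcoef p N i * (1 - p) ^ N = of_nat (N choose i) * p ^ i * (1 - p) ^ (N - i)"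
    using q ij(1) by (simp add: kcoef_def power_divide power_diff)
  then have "B (Yvar ^ (N - i) * Zvar ^ i) (ystar ^ (N - j) * zstar ^ j) =
      (\<Sum>n\<le>i. (-1) ^ n * of_nat (j choose n) * of_nat (N - n choose (i - n)) * p ^ (i - n) * (1 - p) ^ (N - i))
        / (of_nat (N choose i) * p ^ i * (1 - p) ^ (N - i))"
    using krawtchouk_form_monomial_left[OF assms(5) ij(1) dual_monomial_in_homog_space[OF ij(2), of p]]
      coeff_dual_monomial[OF ij(2,1), of p] by (simp only: assms(6,7))
  also have "\<dots> = poly (krawtchouk p N i) (of_nat j)"
    unfolding krawtchouk_eval[OF assms(4,2) ij(1)] sum_divide_distrib
    using q assms(2) by (intro sum.cong) (simp_all add: power_diff mult_ac)
  finally show "B (Yvar ^ (N - i) * Zvar ^ i) (ystar ^ (N - j) * zstar ^ j)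
      = poly (krawtchouk p N i) (of_nat j)" .
qed

end
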